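(* Let $\mathcal{B}\subset\mathcal{A}$ be an inclusion of simple unital $C^*$-algebras (with common unit) with a finite-index conditional expectation $E:\mathcal{A}\to\mathcal{B}$. Then, for any $0<\gamma<\frac{1}{10^6}$, $$\Big\{u\in\mathcal{N}_{\mathcal{A}}(\mathcal{B}):\|u-\mathbf{1}\|<\frac{\gamma}{2}\Big\}\subseteq\bigcap\{\mathcal{N}_{\mathcal{A}}(\mathcal{C}):\mathcal{C}\in\mathcal{I}_0(\mathcal{B}\subset\mathcal{A})\}.$$ In particular, if $\mathcal{C}_{\mathcal{A}}(\mathcal{B})\subseteq\mathcal{B}$, then $$\Big\{u\in\mathcal{N}_{\mathcal{A}}(\mathcal{B}):\|u-\mathbf{1}\|<\frac{\gamma}{2}\Big\}\subseteq\bigcap\{\mathcal{N}_{\mathcal{A}}(\mathcal{C}):\mathcal{C}\in\mathcal{I}(\mathcal{B}\subset\mathcal{A})\}.$$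
   Context: $\mathcal{U}(\mathcal{A})$ is the unitary group of $\mathcal{A}$; $\mathcal{N}_{\mathcal{A}}(\mathcal{C})=\{u\in\mathcal{U}(\mathcal{A}):u\mathcal{C}u^*=\mathcal{C}\}$; $\mathcal{C}_{\mathcal{A}}(\mathcal{C})=\{x\in\mathcal{A}:cx=xc\ \forall c\in\mathcal{C}\}$. A conditional expectation $E:\mathcal{A}\to\mathcal{B}$ has finite index if there is a finite set $\{\lambda_1,\dots,\lambda_n\}\subset\mathcal{A}$ with $x=\sum_iE(x\lambda_i)\lambda_i^*$ for all $x\in\mathcal{A}$. $\mathcal{I}(\mathcal{B}\subset\mathcal{A})$ is the set of all intermediate $C^*$-subalgebras $\mathcal{B}\subseteq\mathcal{C}\subseteq\mathcal{A}$, and $\mathcal{I}_0(\mathcal{B}\subset\mathcal{A})=\{\mathcal{C}\in\mathcal{I}(\mathcal{B}\subset\mathcal{A}):\mathcal{C}_{\mathcal{A}}(\mathcal{B})\subseteq\mathcal{C}_{\mathcal{A}}(\mathcal{C})\cup\mathcal{C}\}$. *)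

theory Defs
  imports Complex_Main
begin

text \<open>The algebra \<open>\<A>\<close> is a type of the following class, so \<open>\<A>\<close> itself is \<open>UNIV\<close>;
  its C*-subalgebras are sets of elements of that type. The normalisation
  \<open>norm 1 = 1\<close> of \<open>real_normed_algebra_1\<close> only excludes the zero algebra.\<close>

class unital_cstar_algebra = real_normed_algebra_1 + banach +
  fixes scaleC :: "complex \<Rightarrow> 'a \<Rightarrow> 'a"  (infixr \<open>*\<^sub>C\<close> 75)
    and star :: "'a \<Rightarrow> 'a"
  assumes scaleC_add_right: "c *\<^sub>C (x + y) = c *\<^sub>C x + c *\<^sub>C y"
    and scaleC_add_left: "(c + d) *\<^sub>C x = c *\<^sub>C x + d *\<^sub>C x"
    and scaleC_scaleC: "c *\<^sub>C (d *\<^sub>C x) = (c * d) *\<^sub>C x"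
    and scaleC_of_real: "complex_of_real r *\<^sub>C x = r *\<^sub>R x"
    and mult_scaleC_left: "(c *\<^sub>C x) * y = c *\<^sub>C (x * y)"
    and mult_scaleC_right: "x * (c *\<^sub>C y) = c *\<^sub>C (x * y)"
    and norm_scaleC: "norm (c *\<^sub>C x) = cmod c * norm x"
    and star_star: "star (star x) = x"
    and star_add: "star (x + y) = star x + star y"
    and star_scaleC: "star (c *\<^sub>C x) = cnj c *\<^sub>C star x"
    and star_mult: "star (x * y) = star y * star x"
    and cstar_identity: "norm (star x * x) = (norm x)\<^sup>2"

instantiation complex :: unital_cstar_algebra
begin

definition scaleC_complex :: "complex \<Rightarrow> complex \<Rightarrow> complex"
  where "scaleC_complex c x = c * x"

definition star_complex :: "complex \<Rightarrow> complex"
  where "star_complex x = cnj x"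

instance
  by standard
    (simp_all add: scaleC_complex_def star_complex_def algebra_simps scaleR_conv_of_real
      norm_mult power2_eq_square)

end

definition cstar_subalgebra :: "'a::unital_cstar_algebra set \<Rightarrow> bool"
  where "cstar_subalgebra S \<longleftrightarrow>
    closed S \<and> 0 \<in> S \<and>
    (\<forall>x\<in>S. \<forall>y\<in>S. x + y \<in> S \<and> x * y \<in> S) \<and>
    (\<forall>c. \<forall>x\<in>S. c *\<^sub>C x \<in> S) \<and>
    (\<forall>x\<in>S. star x \<in> S)"

definition closed_two_sided_ideal :: "'a::unital_cstar_algebra set \<Rightarrow> 'a set \<Rightarrow> bool"
  where "closed_two_sided_ideal J S \<longleftrightarrow>
    J \<subseteq> S \<and> closed J \<and> 0 \<in> J \<and>
    (\<forall>x\<in>J. \<forall>y\<in>J. x + y \<in> J) \<and>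
    (\<forall>c. \<forall>x\<in>J. c *\<^sub>C x \<in> J) \<and>
    (\<forall>s\<in>S. \<forall>x\<in>J. s * x \<in> J \<and> x * s \<in> J)"

definition simple_cstar_algebra :: "'a::unital_cstar_algebra set \<Rightarrow> bool"
  where "simple_cstar_algebra S \<longleftrightarrow>
    cstar_subalgebra S \<and> S \<noteq> {0} \<and>
    (\<forall>J. closed_two_sided_ideal J S \<longrightarrow> J = {0} \<or> J = S)"

definition cstar_positive :: "'a::unital_cstar_algebra \<Rightarrow> bool"
  where "cstar_positive x \<longleftrightarrow> (\<exists>y. x = star y * y)"

text \<open>A positive contractive linear projection of \<open>\<A>\<close> onto \<open>B\<close> that is a \<open>B\<close>-bimodule map.
  For \<open>B\<close> a C*-subalgebra, positivity in \<open>B\<close> and in \<open>\<A>\<close> coincide.\<close>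

definition conditional_expectation ::
    "('a::unital_cstar_algebra \<Rightarrow> 'a) \<Rightarrow> 'a set \<Rightarrow> bool"
  where "conditional_expectation E B \<longleftrightarrow>
    (\<forall>x. E x \<in> B) \<and>
    (\<forall>b\<in>B. E b = b) \<and>
    (\<forall>x y. E (x + y) = E x + E y) \<and>
    (\<forall>c x. E (c *\<^sub>C x) = c *\<^sub>C E x) \<and>
    (\<forall>x. cstar_positive x \<longrightarrow> cstar_positive (E x)) \<and>
    (\<forall>x. norm (E x) \<le> norm x) \<and>
    (\<forall>b\<in>B. \<forall>x. E (b * x) = b * E x \<and> E (x * b) = E x * b)"

definition finite_index :: "('a::unital_cstar_algebra \<Rightarrow> 'a) \<Rightarrow> bool"
  where "finite_index E \<longleftrightarrow>
    (\<exists>(n::nat) l. \<forall>x. x = (\<Sum>i<n. E (x * l i) * star (l i)))"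

definition unitary_group :: "'a::unital_cstar_algebra set"
  where "unitary_group = {u. star u * u = 1 \<and> u * star u = 1}"

definition normalizer :: "'a::unital_cstar_algebra set \<Rightarrow> 'a set"
  where "normalizer C = {u \<in> unitary_group. (\<lambda>c. u * c * star u) ` C = C}"

definition centralizer :: "'a::unital_cstar_algebra set \<Rightarrow> 'a set"
  where "centralizer C = {x. \<forall>c\<in>C. c * x = x * c}"

definition intermediate :: "'a::unital_cstar_algebra set \<Rightarrow> 'a set set"
  where "intermediate B = {C. cstar_subalgebra C \<and> B \<subseteq> C}"

definition intermediate0 :: "'a::unital_cstar_algebra set \<Rightarrow> 'a set set"
  where "intermediate0 B =
    {C \<in> intermediate B. centralizer B \<subseteq> centralizer C \<union> C}"

end

theory Submission
  imports Defs
begin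

text \<open>
  Let \<open>u\<close> normalise \<open>B\<close> with \<open>\<parallel>u - 1\<parallel> < 1\<close>. Applying \<open>E\<close> to \<open>u b = (u b u\<^sup>*) u\<close> gives
  \<open>E(u) b = (u b u\<^sup>*) E(u)\<close> for \<open>b \<in> B\<close>, and \<open>E(u)\<close> is invertible in \<open>B\<close> because
  \<open>\<parallel>E(u) - 1\<parallel> \<le> \<parallel>u - 1\<parallel> < 1\<close>. Hence \<open>u = E(u) w\<close> with \<open>w = E(u)\<^sup>-\<^sup>1 u\<close> commuting with \<open>B\<close>.
  If \<open>w \<in> C\<close> then \<open>u \<in> C\<close>; if \<open>w\<close> commutes with \<open>C\<close> then \<open>u\<close> acts on \<open>C\<close> as
  conjugation by \<open>E(u) \<in> C\<close>. In both cases \<open>u C u\<^sup>* = C\<close>.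
\<close>

lemma cstar_subalgebra_power:
  assumes "cstar_subalgebra S" "1 \<in> S" "x \<in> S"
  shows "x ^ n \<in> S"
  using assms by (induction n) (auto simp: cstar_subalgebra_def)

lemma cstar_subalgebra_sum:
  assumes "cstar_subalgebra S" "\<And>i. i \<in> I \<Longrightarrow> f i \<in> S"
  shows "sum f I \<in> S"
  using assms(2)
  by (induction I rule: infinite_finite_induct)
    (use assms(1) in \<open>auto simp: cstar_subalgebra_def\<close>)

text \<open>The inverse is the Neumann series of \<open>x\<close>. Its partial sums are polynomials
  in \<open>x\<close>, so closedness of \<open>S\<close> keeps the limit in
  \<open>S\<close>.\<close>

lemma cstar_subalgebra_neumann_inverse:
  fixes x :: "'a::unital_cstar_algebra"
  assumes S: "cstar_subalgebra S" "1 \<in> S" and x: "x \<in> S" "norm x < 1"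
  obtains y where "y \<in> S" "(1 - x) * y = 1" "y * (1 - x) = 1"
proof
  define y where "y = (\<Sum>n. x ^ n)"
  have sm: "summable (\<lambda>n. x ^ n)"
    using x(2) by (rule complete_algebra_summable_geometric)
  \<comment> \<open>Splitting off the term of index 0 yields both \<open>y = 1 + x * y\<close> and
    \<open>y = 1 + y * x\<close>, one for each side of the inverse.\<close>
  have shift: "y = 1 + (\<Sum>n. x ^ Suc n)"
    using suminf_split_head[OF sm] by (simp add: y_def)
  have "(\<lambda>n. \<Sum>i<n. x ^ i) \<longlonglongrightarrow> y"
    using sm by (simp add: y_def summable_LIMSEQ)
  moreover have "(\<Sum>i<n. x ^ i) \<in> S" for n
    using S x(1) by (intro cstar_subalgebra_sum cstar_subalgebra_power) auto
  moreover have "closed S"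
    using S(1) by (simp add: cstar_subalgebra_def)
  ultimately show "y \<in> S"
    using closed_sequentially[of S "\<lambda>n. \<Sum>i<n. x ^ i" y] by blast
  have "x * y = (\<Sum>n. x ^ Suc n)"
    using suminf_mult[OF sm, of x] by (simp add: y_def)
  then show "(1 - x) * y = 1"
    using shift by (simp add: algebra_simps)
  have "y * x = (\<Sum>n. x ^ Suc n)"
    using suminf_mult2[OF sm, of x] by (simp add: y_def power_commutes)
  then show "y * (1 - x) = 1"
    using shift by (simp add: algebra_simps)
qed

text \<open>The factors do not depend on any intermediate algebra. Having both \<open>a\<close> and
  \<open>a'\<close> in \<open>B\<close> puts them in every \<open>C\<close> containing
  \<open>B\<close>.\<close>

lemma normalizer_near_one_factorization:
  fixes B :: "'a::unital_cstar_algebra set"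
  assumes B: "cstar_subalgebra B" "1 \<in> B"
    and E: "conditional_expectation E B"
    and u: "u \<in> normalizer B" "norm (u - 1) < 1"
  obtains a a' w where "a \<in> B" "a' \<in> B" "a * a' = 1" "a' * a = 1"
    "w \<in> centralizer B" "u = a * w"
proof -
  have EB: "E x \<in> B" and E_add: "E (x + y) = E x + E y" and E_norm: "norm (E x) \<le> norm x" for x y
    using E by (auto simp: conditional_expectation_def)
  have E_mod: "E (b * x) = b * E x" "E (x * b) = E x * b" if "b \<in> B" for b x
    using E that by (auto simp: conditional_expectation_def)
  have "E 1 = 1"
    using E B(2) by (auto simp: conditional_expectation_def)
  then have Eu: "E u = 1 - E (1 - u)"
    using E_add[of u "1 - u"] by (simp add: algebra_simps)
  have "norm (E (1 - u)) < 1"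
    using E_norm[of "1 - u"] u(2) by (simp add: norm_minus_commute)
  then obtain a' where a': "a' \<in> B" "E u * a' = 1" "a' * E u = 1"
    unfolding Eu by (rule cstar_subalgebra_neumann_inverse[OF B EB])
  have "b * (a' * u) = (a' * u) * b" if b: "b \<in> B" for b
  proof -
    define b' where "b' = u * b * star u"
    have "b' \<in> B"
      using u(1) b by (auto simp: b'_def normalizer_def)
    have ub: "u * b = b' * u"
      using u(1) by (simp add: b'_def normalizer_def unitary_group_def mult.assoc)
    \<comment> \<open>Since \<open>b\<close> and \<open>b'\<close> both lie in \<open>B\<close>, the
      bimodule property moves them out of \<open>E (u * b) = E (b' * u)\<close>.\<close>
    have "E u * b = b' * E u"
      using E_mod(2)[OF b, of u] E_mod(1)[OF \<open>b' \<in> B\<close>, of u] ub by simp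
    \<comment> \<open>Multiplying by \<open>a'\<close> on both sides trades the intertwining
      relation of \<open>E u\<close> for one of its inverse.\<close>
    then have "(a' * E u) * b * a' = a' * b' * (E u * a')"
      by (simp add: mult.assoc)
    then have "b * a' = a' * b'"
      by (simp add: a')
    then have "b * a' * u = a' * b' * u"
      by simp
    then show ?thesis
      by (simp add: mult.assoc ub)
  qed
  then have "a' * u \<in> centralizer B"
    by (simp add: centralizer_def)
  moreover have "u = E u * (a' * u)"
    by (simp add: a' flip: mult.assoc)
  ultimately show thesis
    using that EB a' by blast
qed

lemma normalizer_if_mem:
  assumes C: "cstar_subalgebra C" and u: "u \<in> unitary_group" "u \<in> C"
  shows "u \<in> normalizer C"
proof -
  have mult: "x * y \<in> C" if "x \<in> C" "y \<in> C" for x y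
    using C that by (simp add: cstar_subalgebra_def)
  have su: "star u \<in> C"
    using C u(2) by (simp add: cstar_subalgebra_def)
  have uu: "u * star u = 1"
    using u(1) by (simp add: unitary_group_def)
  have "c \<in> (\<lambda>c. u * c * star u) ` C" if "c \<in> C" for c
  proof
    show "c = u * (star u * c * u) * star u"
    proof -
      have "u * (star u * c * u) * star u = (u * star u) * c * (u * star u)"
        by (simp only: mult.assoc)
      then show ?thesis
        by (simp add: uu)
    qed
    show "star u * c * u \<in> C"
      using mult su u(2) that by blast
  qed
  then show ?thesis
    using u mult su by (auto simp: normalizer_def)
qed

text \<open>Moving \<open>w\<close> past \<open>c\<close> leaves the factor
  \<open>w * star u\<close>, which equals \<open>a'\<close> because \<open>u\<close> is unitary.
  Thus \<open>u\<close> acts on \<open>C\<close> as the inner automorphism given by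
  \<open>a\<close>, even though \<open>a\<close> itself is not assumed unitary.\<close>

lemma normalizer_if_mult_centralizer:
  assumes C: "cstar_subalgebra C" and u: "u \<in> unitary_group"
    and a: "a \<in> C" "a' \<in> C" "a * a' = 1" "a' * a = 1"
    and w: "w \<in> centralizer C" "u = a * w"
  shows "u \<in> normalizer C"
proof -
  have mult: "x * y \<in> C" if "x \<in> C" "y \<in> C" for x y
    using C that by (simp add: cstar_subalgebra_def)
  have uu: "u * star u = 1"
    using u by (simp add: unitary_group_def)
  have "w * star u = (a' * a) * w * star u"
    by (simp add: a(4))
  also have "\<dots> = a' * (u * star u)"
    by (simp add: w(2) mult.assoc)
  finally have ws: "w * star u = a'"
    by (simp add: uu)
  have conj: "u * c * star u = a * c * a'" if "c \<in> C" for c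
  proof -
    have "u * c * star u = a * (w * c) * star u"
      by (simp add: w(2) mult.assoc)
    also have "w * c = c * w"
      using w(1) that by (simp add: centralizer_def)
    also have "a * (c * w) * star u = a * c * a'"
      by (simp add: mult.assoc ws)
    finally show ?thesis .
  qed
  have "c \<in> (\<lambda>c. u * c * star u) ` C" if "c \<in> C" for c
  proof
    show mem: "a' * c * a \<in> C"
      using mult a that by blast
    show "c = u * (a' * c * a) * star u"
    proof -
      have "a * (a' * c * a) * a' = (a * a') * c * (a * a')"
        by (simp only: mult.assoc)
      then show ?thesis
        by (simp add: conj[OF mem] a(3))
    qed
  qed
  then show ?thesis
    using u mult a by (auto simp: normalizer_def conj)
qed

lemma normalizer_near_one_normalizes_intermediate0:
  fixes B :: "'a::unital_cstar_algebra set"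
  assumes B: "cstar_subalgebra B" "1 \<in> B"
    and E: "conditional_expectation E B"
    and u: "u \<in> normalizer B" "norm (u - 1) < 1"
    and C: "C \<in> intermediate0 B"
  shows "u \<in> normalizer C"
proof -
  obtain a a' w where aw: "a \<in> B" "a' \<in> B" "a * a' = 1" "a' * a = 1"
    "w \<in> centralizer B" "u = a * w"
    using normalizer_near_one_factorization[OF B E u] by blast
  have C': "cstar_subalgebra C" "a \<in> C" "a' \<in> C" "w \<in> centralizer C \<union> C"
    using C aw by (auto simp: intermediate0_def intermediate_def)
  have U: "u \<in> unitary_group"
    using u(1) by (simp add: normalizer_def)
  \<comment> \<open>The union in the definition of \<open>intermediate0\<close> is used at the
    single element \<open>w\<close>.\<close>
  from C'(4) show ?thesis
  proof
    assume "w \<in> centralizer C"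
    then show ?thesis
      using normalizer_if_mult_centralizer C' U aw by blast
  next
    assume "w \<in> C"
    then have "u \<in> C"
      using C' aw(6) by (simp add: cstar_subalgebra_def)
    then show ?thesis
      using normalizer_if_mem C'(1) U by blast
  qed
qed

theorem corollary3p9:
  fixes B :: "'a::unital_cstar_algebra set"
    and E :: "'a \<Rightarrow> 'a"
    and \<gamma> :: real
  assumes "simple_cstar_algebra (UNIV :: 'a set)"
    and "simple_cstar_algebra B"
    and "1 \<in> B"
    and "conditional_expectation E B"
    and "finite_index E"
    and "0 < \<gamma>"
    and "\<gamma> < 1 / 10 ^ 6"
  shows "{u \<in> normalizer B. norm (u - 1) < \<gamma> / 2} \<subseteq> (\<Inter>C\<in>intermediate0 B. normalizer C)
    \<and> (centralizer B \<subseteq> B \<longrightarrow>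
        {u \<in> normalizer B. norm (u - 1) < \<gamma> / 2} \<subseteq> (\<Inter>C\<in>intermediate B. normalizer C))"
proof -
  have B: "cstar_subalgebra B"
    using assms(2) by (simp add: simple_cstar_algebra_def)
  \<comment> \<open>This places \<open>u\<close> within distance 1 of the unit, where
    \<open>E u\<close> is invertible.\<close>
  have "\<gamma> / 2 < 1"
    using assms(7) by simp
  then have main: "u \<in> normalizer C"
    if "u \<in> normalizer B" "norm (u - 1) < \<gamma> / 2" "C \<in> intermediate0 B" for u C
    using normalizer_near_one_normalizes_intermediate0[OF B assms(3,4) that(1) _ that(3)] that(2)
    by linarith
  \<comment> \<open>Here the centralizer of \<open>B\<close> lies in \<open>B\<close>, hence in each
    intermediate \<open>C\<close>.\<close>
  moreover have "intermediate B \<subseteq> intermediate0 B" if "centralizer B \<subseteq> B"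
    using that by (auto simp: intermediate0_def intermediate_def)
  ultimately show ?thesis
    by blast
qed

end
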